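(* Let $G$ be an arbitrary finite abstract simplicial complex of maximal dimension $q$ with vertex set $V$. Let $g:V\to\{-1,1\}$ be a random function distributed according to the Bayes measure $P$, and let $H=G_g$ be the resulting random $(q-1)$-complex in $G$. Then the expected inherited $f$-function of $H$ is, as an identity of polynomials in $t$, $$\mathrm{E}[e_H(t)] = 2-2K_G(t)+f_G(t).$$
   Context: A finite abstract simplicial complex $G$ is a finite set of non-empty finite sets closed under taking non-empty subsets. For $x\in G$, $\dim(x)=|x|-1$. Its vertex set is $V=\bigcup_{x\in G}x$. Write $f_k(G)$ for the number of $x\in G$ with $\dim(x)=k$. Simplex generating function: $f_G(t)=1+f_0(G)t+f_1(G)t^2+\cdots+f_q(G)t^{q+1}$. Curvature generating function: $K_G(t)=1+f_0(G)\frac{t}{2}+f_1(G)\frac{t^2}{3}+\cdots+f_q(G)\frac{t^{q+1}}{q+2}$. Level surface: for $g:V\to\{-1,1\}$, $G_g=\{x\in G : g(x)=\{-1,1\}\}$, i.e. the set of simplices of $G$ on which $g$ takes both values. Inherited $f$-function: for $H=G_g$, $e_H(t)=1+\sum_{x\in H}t^{|x|}=1+e_0t^2+e_1t^3+\cdots+e_{q-1}t^{q+1}$, where $e_k$ is the number of $x\in H$ with $|x|=k+2$, i.e. of $(k+1)$-dimensional simplices of $G$ belonging to $H$ (there is no linear term, since $g$ is constant on a single vertex). Bayes measure: with $n=|V|$, $P$ is the probability measure on $\{-1,1\}^V$ obtained by choosing $p$ uniformly in $[0,1]$ and then, given $p$, letting the values $g(v)$, $v\in V$, be independent with value $1$ with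 probability $p$ and $-1$ with probability $1-p$. Equivalently, $P(\{g\})=\frac{1}{(n+1)\binom{n}{m}}$ if $g$ takes the value $1$ exactly $m$ times. $\mathrm{E}$ denotes expectation with respect to $P$, taken coefficientwise for polynomials. *)

theory Defs
  imports "HOL-Probability.Probability" "HOL-Computational_Algebra.Polynomial"
begin

definition abstract_simplicial_complex :: "'a set set \<Rightarrow> bool" where
  "abstract_simplicial_complex G \<longleftrightarrow>
     finite G \<and> (\<forall>x\<in>G. finite x \<and> x \<noteq> {}) \<and>
     (\<forall>x\<in>G. \<forall>y. y \<subseteq> x \<and> y \<noteq> {} \<longrightarrow> y \<in> G)"

definition vertex_set :: "'a set set \<Rightarrow> 'a set" where
  "vertex_set G = \<Union>G"

definition simplex_dim :: "'a set \<Rightarrow> int" where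
  "simplex_dim x = int (card x) - 1"

(* The maximal dimension; the empty complex gets dimension -1. *)
definition complex_dim :: "'a set set \<Rightarrow> int" where
  "complex_dim G = Max (insert (-1) (simplex_dim ` G))"

definition f_number :: "'a set set \<Rightarrow> nat \<Rightarrow> nat" where
  "f_number G k = card {x \<in> G. simplex_dim x = int k}"

definition f_poly :: "'a set set \<Rightarrow> real poly" where
  "f_poly G = 1 + (\<Sum>k | int k \<le> complex_dim G. monom (real (f_number G k)) (k + 1))"

definition curvature_poly :: "'a set set \<Rightarrow> real poly" where
  "curvature_poly G =
     1 + (\<Sum>k | int k \<le> complex_dim G. monom (real (f_number G k) / real (k + 2)) (k + 1))"

definition level_surface :: "'a set set \<Rightarrow> ('a \<Rightarrow> int) \<Rightarrow> 'a set set" where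
  "level_surface G g = {x \<in> G. g ` x = {-1, 1}}"

(* The exponent is the cardinality of x as a simplex of the ambient complex,
   not its dimension-shifted size inside the level surface. *)
definition inherited_f_poly :: "'a set set \<Rightarrow> real poly" where
  "inherited_f_poly H = 1 + (\<Sum>x\<in>H. monom 1 (card x))"

definition sign_pmf :: "real \<Rightarrow> int pmf" where
  "sign_pmf p = map_pmf (\<lambda>b. if b then 1 else -1) (bernoulli_pmf p)"

(* Functions on V are represented by total functions that are undefined outside V.
   The first argument of bind is the uniform distribution of p on [0,1], the second
   the law of independent signs g v (v in V) that are 1 with probability p. *)
definition bayes_measure :: "'a set \<Rightarrow> ('a \<Rightarrow> int) measure" where
  "bayes_measure V =
     bind (uniform_measure lborel {0..1})
       (\<lambda>p. measure_pmf (Pi_pmf V undefined (\<lambda>_. sign_pmf p)))"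

lemma set_sign_pmf: "set_pmf (sign_pmf p) \<subseteq> {-1, 1}"
  by (auto simp: sign_pmf_def)

lemma pmf_sign_pmf:
  "pmf (sign_pmf p) s =
     (if s = 1 then min 1 (max 0 p) else if s = -1 then 1 - min 1 (max 0 p) else 0)"
proof -
  have eq: "(\<lambda>b. if b then 1 else - 1 :: int) -` {s} = (if s = 1 then {True} else if s = -1 then {False} else {})"
    by (auto split: if_splits)
  show ?thesis unfolding sign_pmf_def pmf_map eq
    by (auto simp: measure_pmf_single bernoulli_pmf.rep_eq min_def max_def)
qed

lemma measurable_bayes_kernel:
  assumes "finite V"
  shows "(\<lambda>p. measure_pmf (Pi_pmf V undefined (\<lambda>_. sign_pmf p)))
           \<in> borel \<rightarrow>\<^sub>M subprob_algebra (count_space UNIV)"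
proof (rule measurable_subprob_algebra)
  fix A :: "('a \<Rightarrow> int) set"
  define S where "S = PiE_dflt V (undefined :: int) (\<lambda>_::'a. {-1, 1::int})"
  have fin: "finite S" unfolding S_def using assms by (intro finite_PiE_dflt) auto
  have set: "set_pmf (Pi_pmf V undefined (\<lambda>_. sign_pmf p)) \<subseteq> S" for p
    using set_sign_pmf set_Pi_pmf_subset'[OF assms, of undefined "\<lambda>_. sign_pmf p"]
    by (fastforce simp: S_def PiE_dflt_def)
  have "emeasure (measure_pmf (Pi_pmf V undefined (\<lambda>_. sign_pmf p))) A =
        (\<Sum>f\<in>A \<inter> S. ennreal (pmf (Pi_pmf V undefined (\<lambda>_. sign_pmf p)) f))" for p
  proof -
    have "emeasure (measure_pmf (Pi_pmf V undefined (\<lambda>_. sign_pmf p))) A = 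
          emeasure (measure_pmf (Pi_pmf V undefined (\<lambda>_. sign_pmf p))) (A \<inter> S)"
      using set by (intro emeasure_eq_AE) (auto simp: AE_measure_pmf_iff)
    also have "\<dots> = (\<Sum>f\<in>A \<inter> S. ennreal (pmf (Pi_pmf V undefined (\<lambda>_. sign_pmf p)) f))"
      using fin by (subst emeasure_measure_pmf_finite) auto
    finally show ?thesis .
  qed
  moreover have "(\<lambda>p. \<Sum>f\<in>A \<inter> S. ennreal (pmf (Pi_pmf V undefined (\<lambda>_. sign_pmf p)) f)) \<in> borel_measurable borel"
  proof (intro borel_measurable_sum measurable_compose[OF _ measurable_ennreal])
    have s: "(\<lambda>p. pmf (sign_pmf p) s) \<in> borel_measurable borel" for s
      unfolding pmf_sign_pmf by measurable
    fix f :: "'a \<Rightarrow> int"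
    show "(\<lambda>p. pmf (Pi_pmf V undefined (\<lambda>_. sign_pmf p)) f) \<in> borel_measurable borel"
      unfolding pmf_Pi[OF assms] by (intro measurable_If borel_measurable_prod s) auto
  qed
  ultimately show "(\<lambda>p. emeasure (measure_pmf (Pi_pmf V undefined (\<lambda>_. sign_pmf p))) A) \<in> borel_measurable borel"
    by simp
qed (auto intro: measure_pmf.subprob_space_axioms)

lemma prob_space_bayes_measure:
  assumes "finite V"
  shows "prob_space (bayes_measure V)" "sets (bayes_measure V) = UNIV"
proof -
  have u: "prob_space (uniform_measure lborel {0..1::real})"
    by (rule prob_space_uniform_measure) auto
  have k: "(\<lambda>p. measure_pmf (Pi_pmf V undefined (\<lambda>_. sign_pmf p)))
           \<in> uniform_measure lborel {0..1} \<rightarrow>\<^sub>M subprob_algebra (count_space UNIV)"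
    using measurable_bayes_kernel[OF assms] by (simp cong: measurable_cong_sets)
  show "prob_space (bayes_measure V)" unfolding bayes_measure_def
    by (rule prob_space.prob_space_bind[OF u _ k]) (auto intro: measure_pmf.prob_space_axioms)
  show "sets (bayes_measure V) = UNIV" unfolding bayes_measure_def
    by (subst sets_bind[where N="count_space UNIV"]) auto
qed

(* Meaningful when the degrees of the random polynomial are bounded, so that
   only finitely many coefficients are nonzero; see the lemma below. *)
definition poly_expectation :: "'b measure \<Rightarrow> ('b \<Rightarrow> real poly) \<Rightarrow> real poly" where
  "poly_expectation M F = Abs_poly (\<lambda>k. \<integral>\<omega>. coeff (F \<omega>) k \<partial>M)"

lemma coeff_poly_expectation:
  assumes "\<And>\<omega>. \<omega> \<in> space M \<Longrightarrow> degree (F \<omega>) \<le> d"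
  shows "coeff (poly_expectation M F) k = (\<integral>\<omega>. coeff (F \<omega>) k \<partial>M)"
proof -
  have "(\<integral>\<omega>. coeff (F \<omega>) i \<partial>M) = 0" if "i > d" for i
  proof -
    have "(\<integral>\<omega>. coeff (F \<omega>) i \<partial>M) = (\<integral>\<omega>. 0 \<partial>M)"
      by (rule Bochner_Integration.integral_cong)
         (use assms that in \<open>auto intro!: coeff_eq_0 intro: le_less_trans\<close>)
    then show ?thesis by simp
  qed
  then show ?thesis
    unfolding poly_expectation_def by (subst coeff_Abs_poly[of d]) auto
qed

end

theory Submission imports Defs begin

text \<open>
  By linearity of expectation, a simplex \<^term>\<open>x\<close> with \<open>k\<close> vertices contributes \<open>t ^ k\<close> times the
  probability that the random signs take both values on it. Given the bias \<open>p\<close>, the signs are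
  constant on \<^term>\<open>x\<close> with probability \<open>p ^ k + (1 - p) ^ k\<close>; averaging over \<open>p \<in> [0, 1]\<close> turns each
  of these powers into \<open>1 / (k + 1)\<close> (lemma \<open>prob_bayes_both_signs\<close>). Hence the expected polynomial is
  \<open>1 + (\<Sum>x\<in>G. (1 - 2 / (card x + 1)) t ^ card x)\<close>.

  Since \<open>1 / (card x + 1)\<close> is precisely the weight of \<^term>\<open>x\<close> in the curvature polynomial, the two
  parts of \<open>1 - 2 / (card x + 1)\<close> yield the simplex polynomial and minus twice the curvature
  polynomial, up to their constant terms. The vertices need no separate treatment: for \<open>k = 1\<close> the
  factor \<open>1 - 2 / (k + 1)\<close> vanishes, as it must, because a sign is constant on a single vertex.
\<close>

lemma integral_uniform_Icc_0_1:
  fixes f :: "real \<Rightarrow> real"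
  assumes "f \<in> borel_measurable borel"
  shows "(\<integral>p. f p \<partial>uniform_measure lborel {0..1}) = (\<integral>p. f p * indicator {0..1} p \<partial>lborel)"
proof -
  have "uniform_measure lborel {0..1::real} = density lborel (\<lambda>p. ennreal (indicator {0..1} p))"
    unfolding uniform_measure_def by (simp add: ennreal_indicator divide_ennreal_def)
  then show ?thesis
    using assms by (simp add: integral_density mult.commute)
qed

lemma prob_Pi_pmf_constant:
  assumes "finite V" "x \<subseteq> V"
  shows "measure_pmf.prob (Pi_pmf V d (\<lambda>_. q)) {g. \<forall>v\<in>x. g v = s} = pmf q s ^ card x"
proof -
  have "{g. \<forall>v\<in>x. g v = s} = Pi V (\<lambda>v. if v \<in> x then {s} else UNIV)"
    using assms(2) by (auto simp: Pi_def split: if_splits)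
  then have "measure_pmf.prob (Pi_pmf V d (\<lambda>_. q)) {g. \<forall>v\<in>x. g v = s} =
      (\<Prod>v\<in>V. measure_pmf.prob q (if v \<in> x then {s} else UNIV))"
    using assms(1) by (simp add: measure_Pi_pmf_Pi)
  also have "\<dots> = (\<Prod>v\<in>x. pmf q s)"
    using assms by (intro prod.mono_neutral_cong_right) (auto simp: measure_pmf_single)
  finally show ?thesis by simp
qed

text \<open>
  Almost surely all signs on \<^term>\<open>x\<close> are \<open>1\<close>, or all are \<open>-1\<close>, or both occur. Nonemptiness of \<^term>\<open>x\<close>
  makes the first two cases exclusive.
\<close>

lemma prob_sign_both_signs:
  fixes x :: "'a set"
  assumes V: "finite V" "x \<subseteq> V" and ne: "x \<noteq> {}" and p: "p \<in> {0..1}"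
  shows "measure_pmf.prob (Pi_pmf V undefined (\<lambda>_. sign_pmf p)) {g. g ` x = {-1, 1}} =
         1 - p ^ card x - (1 - p) ^ card x"
proof -
  let ?P = "Pi_pmf V undefined (\<lambda>_. sign_pmf p)"
  let ?B = "{g. g ` x = {-1, 1}} :: ('a \<Rightarrow> int) set"
  let ?C = "\<lambda>s :: int. {g :: 'a \<Rightarrow> int. \<forall>v\<in>x. g v = s}"
  have "g \<in> ?B \<union> (?C 1 \<union> ?C (-1))" if "g \<in> set_pmf ?P" for g
  proof -
    have "g v \<in> {-1, 1}" if "v \<in> x" for v
      using \<open>g \<in> set_pmf ?P\<close> that V set_Pi_pmf_subset'[OF V(1), of undefined "\<lambda>_. sign_pmf p"]
        set_sign_pmf[of p]
      by (fastforce simp: PiE_dflt_def)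
    then have "g ` x \<subseteq> {-1, 1}" by (rule image_subsetI)
    then have "g ` x = {-1, 1} \<or> g ` x \<subseteq> {1} \<or> g ` x \<subseteq> {-1}"
      unfolding subset_insert_iff by (auto split: if_splits)
    then show ?thesis by auto
  qed
  then have "measure_pmf.prob ?P (?B \<union> (?C 1 \<union> ?C (-1))) = 1"
    by (subst measure_pmf.prob_eq_1) (auto simp: AE_measure_pmf_iff)
  moreover have "?C 1 \<inter> ?C (-1) = {}" using ne by force
  moreover have "?B \<inter> (?C 1 \<union> ?C (-1)) = {}"
  proof -
    have "g ` x \<noteq> {-1, 1}" if "\<forall>v\<in>x. g v = s" for g :: "'a \<Rightarrow> int" and s
    proof -
      have "g ` x \<subseteq> {s}" using that by blast
      then show ?thesis by auto
    qed
    then show ?thesis by blast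
  qed
  ultimately have "measure_pmf.prob ?P ?B + (measure_pmf.prob ?P (?C 1) + measure_pmf.prob ?P (?C (-1))) = 1"
    by (simp add: measure_pmf.finite_measure_Union)
  moreover have "pmf (sign_pmf p) 1 = p" "pmf (sign_pmf p) (-1) = 1 - p"
    using p by (auto simp: pmf_sign_pmf)
  ultimately show ?thesis
    unfolding prob_Pi_pmf_constant[OF V] by simp
qed

lemma integral_both_signs:
  "(\<integral>p. (1 - p ^ k - (1 - p) ^ k) * indicator {0..1} p \<partial>lborel) = 1 - 2 / (real k + 1)"
proof -
  let ?F = "\<lambda>p::real. p - p ^ Suc k / Suc k + (1 - p) ^ Suc k / Suc k"
  have "(\<integral>p. (1 - p ^ k - (1 - p) ^ k) * indicator {0..1} p \<partial>lborel) = ?F 1 - ?F 0"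
  proof (rule integral_FTC_Icc_real)
    fix p :: real
    show "DERIV ?F p :> 1 - p ^ k - (1 - p) ^ k"
      by (auto intro!: derivative_eq_intros simp del: of_nat_Suc power_Suc)
  qed (auto intro!: continuous_intros)
  also have "\<dots> = 1 - 2 / (real k + 1)" by (simp add: add.commute)
  finally show ?thesis .
qed

lemma prob_bayes_both_signs:
  fixes x :: "'a set"
  assumes V: "finite V" "x \<subseteq> V" and ne: "x \<noteq> {}"
  shows "measure (bayes_measure V) {g. g ` x = {-1, 1}} = 1 - 2 / (real (card x) + 1)"
proof -
  let ?U = "uniform_measure lborel {0..1::real}"
  interpret prob_space ?U by (rule prob_space_uniform_measure) auto
  have ker: "(\<lambda>p. measure_pmf (Pi_pmf V undefined (\<lambda>_. sign_pmf p)))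
      \<in> ?U \<rightarrow>\<^sub>M subprob_algebra (count_space UNIV)"
    using measurable_bayes_kernel[OF V(1)] by (simp cong: measurable_cong_sets)
  have "measure (bayes_measure V) {g. g ` x = {-1, 1}} =
      (\<integral>p. measure_pmf.prob (Pi_pmf V undefined (\<lambda>_. sign_pmf p)) {g. g ` x = {-1, 1}} \<partial>?U)"
    unfolding bayes_measure_def by (rule measure_bind[OF ker]) auto
  also have "\<dots> = (\<integral>p. 1 - p ^ card x - (1 - p) ^ card x \<partial>?U)"
  proof (rule integral_cong_AE)
    show "AE p in ?U. measure_pmf.prob (Pi_pmf V undefined (\<lambda>_. sign_pmf p)) {g. g ` x = {-1, 1}} =
        1 - p ^ card x - (1 - p) ^ card x"
      by (rule AE_uniform_measureI) (auto simp: prob_sign_both_signs[OF assms])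
    show "(\<lambda>p. measure_pmf.prob (Pi_pmf V undefined (\<lambda>_. sign_pmf p)) {g. g ` x = {-1, 1}})
        \<in> borel_measurable ?U"
      by (rule measure_measurable_subprob_algebra2[OF _ ker]) auto
  qed simp
  also have "\<dots> = 1 - 2 / (real (card x) + 1)"
    by (simp add: integral_uniform_Icc_0_1 integral_both_signs)
  finally show ?thesis .
qed

text \<open>
  Both polynomials of the complex are sums over dimensions, whereas linearity of expectation needs
  sums over simplices. This regrouping covers both, with weights \<open>1\<close> and \<open>1 / (k + 1)\<close>.
\<close>

lemma sum_f_number_eq_sum_simplices:
  fixes c :: "nat \<Rightarrow> real"
  assumes G: "abstract_simplicial_complex G"
  shows "(\<Sum>k | int k \<le> complex_dim G. monom (real (f_number G k) * c (k + 1)) (k + 1)) =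
         (\<Sum>x\<in>G. monom (c (card x)) (card x))"
proof -
  let ?T = "{k. int k \<le> complex_dim G}"
  have pos: "card x > 0" if "x \<in> G" for x
    using G that by (auto simp: abstract_simplicial_complex_def card_gt_0_iff)
  have finG: "finite G" using G by (simp add: abstract_simplicial_complex_def)
  have "?T \<subseteq> {..nat (complex_dim G)}" by auto
  then have finT: "finite ?T" by (rule finite_subset) simp
  have sub: "(\<lambda>x. card x - 1) ` G \<subseteq> ?T"
  proof (rule image_subsetI, rule CollectI)
    fix x assume "x \<in> G"
    then have "simplex_dim x \<le> complex_dim G"
      unfolding complex_dim_def using finG by (intro Max_ge) auto
    then show "int (card x - 1) \<le> complex_dim G"
      using pos[OF \<open>x \<in> G\<close>] by (simp add: simplex_dim_def of_nat_diff)
  qed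
  have "(\<Sum>x\<in>G. monom (c (card x)) (card x)) =
      (\<Sum>k\<in>?T. \<Sum>x | x \<in> G \<and> card x - 1 = k. monom (c (card x)) (card x))"
    by (rule sum.group[OF finG finT sub, symmetric])
  also have "\<dots> = (\<Sum>k\<in>?T. monom (real (f_number G k) * c (k + 1)) (k + 1))"
  proof (rule sum.cong[OF refl])
    fix k
    have dim: "{x \<in> G. simplex_dim x = int k} = {x \<in> G. card x - 1 = k}"
      using pos by (force simp: simplex_dim_def)
    have "(\<Sum>x | x \<in> G \<and> card x - 1 = k. monom (c (card x)) (card x)) =
        (\<Sum>x | x \<in> G \<and> card x - 1 = k. monom (c (k + 1)) (k + 1))"
      using pos by (intro sum.cong refl) fastforce
    then show "(\<Sum>x | x \<in> G \<and> card x - 1 = k. monom (c (card x)) (card x)) =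
        monom (real (f_number G k) * c (k + 1)) (k + 1)"
      by (simp add: f_number_def dim of_nat_monom mult_monom)
  qed
  finally show ?thesis ..
qed

lemma expected_inherited_f_poly:
  fixes G :: "'a set set"
  assumes G: "abstract_simplicial_complex G"
  shows "poly_expectation (bayes_measure (vertex_set G)) (\<lambda>g. inherited_f_poly (level_surface G g)) =
         1 + (\<Sum>x\<in>G. monom (1 - 2 / (real (card x) + 1)) (card x))"
proof (rule poly_eqI)
  fix k
  let ?M = "bayes_measure (vertex_set G)"
  have finG: "finite G" and finV: "finite (vertex_set G)"
    using G by (auto simp: abstract_simplicial_complex_def vertex_set_def)
  interpret prob_space ?M by (rule prob_space_bayes_measure(1)[OF finV])
  have sets[simp]: "sets ?M = UNIV" by (rule prob_space_bayes_measure(2)[OF finV])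
  have space[simp]: "space ?M = UNIV" using sets_eq_imp_space_eq[of ?M "count_space UNIV"] by simp
  have deg: "degree (inherited_f_poly (level_surface G g)) \<le> (\<Sum>x\<in>G. card x)" for g
    unfolding inherited_f_poly_def level_surface_def
    using finG by (intro degree_add_le degree_sum_le)
      (auto intro: order_trans[OF degree_monom_le] member_le_sum)
  have coeff: "coeff (inherited_f_poly (level_surface G g)) k =
      coeff 1 k + (\<Sum>x\<in>G. (if card x = k then 1 else 0) * indicator {g. g ` x = {-1, 1}} g)" for g
  proof -
    have "(\<Sum>x\<in>level_surface G g. coeff (monom (1::real) (card x)) k) =
        (\<Sum>x\<in>G. (if card x = k then 1 else 0) * indicator {g. g ` x = {-1, 1}} g)"
      unfolding level_surface_def using finG
      by (intro sum.mono_neutral_cong_left) auto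
    then show ?thesis by (simp add: inherited_f_poly_def coeff_sum)
  qed
  have "coeff (poly_expectation ?M (\<lambda>g. inherited_f_poly (level_surface G g))) k =
      (\<integral>g. coeff 1 k + (\<Sum>x\<in>G. (if card x = k then 1 else 0) * indicator {g. g ` x = {-1, 1}} g) \<partial>?M)"
    unfolding coeff[symmetric] by (rule coeff_poly_expectation[OF deg])
  also have "\<dots> = coeff 1 k + (\<Sum>x\<in>G. (if card x = k then 1 else 0) * prob {g. g ` x = {-1, 1}})"
  proof -
    have int: "integrable ?M (\<lambda>g. (if card x = k then 1 else 0) * indicator {g. g ` x = {-1, 1}} g :: real)"
      for x :: "'a set"
      by (intro integrable_mult_right integrable_real_indicator) (auto simp: emeasure_eq_measure)
    show ?thesis
      by (subst Bochner_Integration.integral_add[OF _ Bochner_Integration.integrable_sum[OF int]])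
         (simp_all add: Bochner_Integration.integral_sum[OF int] prob_space[simplified])
  qed
  also have "\<dots> = coeff (1 + (\<Sum>x\<in>G. monom (1 - 2 / (real (card x) + 1)) (card x))) k"
  proof -
    have "prob {g. g ` x = {-1, 1}} = 1 - 2 / (real (card x) + 1)" if "x \<in> G" for x
      using G that
      by (intro prob_bayes_both_signs[OF finV]) (auto simp: abstract_simplicial_complex_def vertex_set_def)
    then show ?thesis by (auto simp: coeff_sum intro!: sum.cong)
  qed
  finally show "coeff (poly_expectation ?M (\<lambda>g. inherited_f_poly (level_surface G g))) k =
      coeff (1 + (\<Sum>x\<in>G. monom (1 - 2 / (real (card x) + 1)) (card x))) k" .
qed

theorem theorem4:
  fixes G :: "'a set set"
  assumes "abstract_simplicial_complex G"
  shows "poly_expectation (bayes_measure (vertex_set G))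
           (\<lambda>g. inherited_f_poly (level_surface G g))
         = 2 - 2 * curvature_poly G + f_poly G"
proof -
  have f: "f_poly G = 1 + (\<Sum>x\<in>G. monom 1 (card x))"
    using sum_f_number_eq_sum_simplices[OF assms, of "\<lambda>_. 1"] by (simp add: f_poly_def)
  have K: "curvature_poly G = 1 + (\<Sum>x\<in>G. monom (1 / (real (card x) + 1)) (card x))"
    using sum_f_number_eq_sum_simplices[OF assms, of "\<lambda>k. 1 / (real k + 1)"]
    by (simp add: curvature_poly_def add_ac)
  have "(\<Sum>x\<in>G. monom (1 - 2 / (real (card x) + 1)) (card x)) =
      (\<Sum>x\<in>G. monom 1 (card x)) - 2 * (\<Sum>x\<in>G. monom (1 / (real (card x) + 1)) (card x))"
    unfolding sum_distrib_left sum_subtractf[symmetric]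
    by (intro sum.cong refl) (simp add: mult_2 add_monom diff_monom)
  then show ?thesis
    unfolding expected_inherited_f_poly[OF assms] f K by (simp add: algebra_simps)
qed

end
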